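(* Let $\bar a\ge1$, $\bar\theta\ge1$, $\widehat a\ge0$, $\widehat\theta\ge0$, and consider the averaged $N$-agent value-function system with the rescaled coefficients $$\boldsymbol{\bar m}=N^{-\bar\theta}\bar m,\quad \boldsymbol{\bar\alpha}=N^{-\bar a}\bar\alpha,\quad \boldsymbol{\widehat m}=N^{-\widehat\theta}\widehat m,\quad \boldsymbol{\widehat\alpha}=N^{-\widehat a}\widehat\alpha .$$ Assume $f\sim\mathcal{O}(1)$, $l\sim\mathcal{O}(1)$, $p\sim\mathcal{O}(1)$, and that the value function $W$ satisfies $\nabla_{y_i}W(t,y_i,\rho^{N-1}_\Phi(\boldsymbol{y}_{-i}))\sim\mathcal{O}(1)$ and $\nabla_{y_j}W(t,y_i,\rho^{N-1}_\Phi(\boldsymbol{y}_{-i}))\sim\mathcal{O}(1/N)$ for $j\neq i$. Then the set of possible scalings (those for which all terms of the dynamics and of the running cost remain of order $\mathcal{O}(1)$ as $N\to\infty$, as made precise in the context) is exactly the set of $(\widehat\theta,\bar\theta,\widehat a,\bar a)$ satisfying $$\text{(i)}\ \ \widehat a-2\widehat\theta\le0,\qquad \text{(ii)}\ \ \widehat a+1-\widehat\theta-\bar\theta\le0,\qquad \text{(iii)}\ \ 2\widehat a+1-2\widehat\theta-\bar a\le0 .$$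
   Context: There are $N$ agents with states $y_i\in\mathbb{R}^d$; $\boldsymbol{y}_{-i}$ denotes all states except the $i$-th, $\Phi:\mathbb{R}^d\to\mathbb{R}$ is a fixed polynomial, $\rho^N_\Phi(\boldsymbol{y})=\frac1N\sum_{k=1}^N\Phi(y_k)$ and $\rho^{N-1}_\Phi(\boldsymbol{y}_{-i})=\frac1{N-1}\sum_{k\ne i}\Phi(y_k)$. The (unscaled, order one) coefficients are $f,\widehat m,\bar m:[0,T]\times\mathbb{R}^d\times\mathbb{R}\to\mathbb{R}^d$, the running cost $l:[0,T]\times\mathbb{R}^d\times\mathbb{R}\to\mathbb{R}$, the terminal payoff $p:\mathbb{R}^d\times\mathbb{R}\to\mathbb{R}$, and constants $\widehat\alpha>0$, $\bar\alpha\ge0$. The value function is $W:[0,T]\times\mathbb{R}^d\times\mathbb{R}\to\mathbb{R}$, evaluated for agent $i$ at $(t,y_i,\rho^{N-1}_\Phi(\boldsymbol{y}_{-i}))$. With the rescaled (boldface) coefficients, the optimal control of agent $i$ is $$p_i^*=\frac{1}{\boldsymbol{\widehat\alpha}}\,\boldsymbol{\widehat m}(t,y_i,\rho^N_\Phi)\cdot\nabla_{y_i}W(t,y_i,\rho^{N-1}_\Phi(\boldsymbol{y}_{-i})),$$ the velocity of agent $i$ is $$f(t,y_i,\rho^N_\Phi)+\boldsymbol{\widehat m}(t,y_i,\rho^N_\Phi)\,p_i^*+\boldsymbol{\bar m}(t,y_i,\rho^N_\Phi)\sum_{k\ne i}p_k^*,$$ and the running cost of agent $i$ is $$l(t,y_i,\rho^N_\Phi)+\frac{\boldsymbol{\widehat\alpha}}{2}(p_i^*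 )^2+\frac{\boldsymbol{\bar\alpha}}{2}\sum_{k\neq i}(p_k^* )^2 .$$ Convention: $g\sim\mathcal{O}(N^s)$ is order counting: $g$ is bounded by a constant (independent of $N$) times $N^s$. The unscaled $\widehat m,\bar m,\widehat\alpha,\bar\alpha$ are treated as quantities of order $\mathcal{O}(1)$ (with $\widehat\alpha$ a fixed positive constant). A quadruple $(\widehat\theta,\bar\theta,\widehat a,\bar a)$ is a possible scaling if, for every choice of such unscaled coefficients and of gradients $\nabla_{y_i}W$ of order $\mathcal{O}(1)$, each of the terms $\boldsymbol{\widehat m}p_i^*$, $\boldsymbol{\bar m}\sum_{k\ne i}p_k^*$, $\frac{\boldsymbol{\widehat\alpha}}{2}(p_i^* )^2$ and $\frac{\boldsymbol{\bar\alpha}}{2}\sum_{k\ne i}(p_k^* )^2$ remains of order $\mathcal{O}(1)$ as $N\to\infty$. *)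

theory Defs
  imports "HOL-Analysis.Analysis"
begin

text \<open>
  Agents are numbered \<open>0, \<dots>, N - 1\<close>, and a configuration of \<open>N\<close> agents is a function
  \<open>y :: nat \<Rightarrow> real ^ 'd\<close> of which only the values at \<open>k < N\<close> are ever used.  Functions of time
  are total, and only their values on \<open>{0..T}\<close> are constrained.
\<close>

text \<open>
  Unscaled data.  The value function of the \<open>N\<close>-agent system depends on \<open>N\<close> through the rescaled
  coefficients and the averages, so it is a family indexed by \<open>N\<close>; the coefficients are not.
\<close>

record 'd agent_data =
  drift :: "real \<Rightarrow> real ^ 'd \<Rightarrow> real \<Rightarrow> real ^ 'd"
  m_hat :: "real \<Rightarrow> real ^ 'd \<Rightarrow> real \<Rightarrow> real ^ 'd"
  m_bar :: "real \<Rightarrow> real ^ 'd \<Rightarrow> real \<Rightarrow> real ^ 'd"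
  cost :: "real \<Rightarrow> real ^ 'd \<Rightarrow> real \<Rightarrow> real"
  payoff :: "real ^ 'd \<Rightarrow> real \<Rightarrow> real"
  alpha_hat :: real
  alpha_bar :: real
  val :: "nat \<Rightarrow> real \<Rightarrow> real ^ 'd \<Rightarrow> real \<Rightarrow> real"

definition rho :: "('a \<Rightarrow> real) \<Rightarrow> nat \<Rightarrow> (nat \<Rightarrow> 'a) \<Rightarrow> real" where
  "rho \<Phi> N y = (\<Sum>k<N. \<Phi> (y k)) / real N"

definition rho_except :: "('a \<Rightarrow> real) \<Rightarrow> nat \<Rightarrow> (nat \<Rightarrow> 'a) \<Rightarrow> nat \<Rightarrow> real" where
  "rho_except \<Phi> N y i = (\<Sum>k\<in>{..<N} - {i}. \<Phi> (y k)) / (real N - 1)"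

definition grad :: "('a::real_inner \<Rightarrow> real) \<Rightarrow> 'a \<Rightarrow> 'a" where
  "grad f x = (THE D. GDERIV f x :> D)"

text \<open>
  The gradient with respect to \<open>y j\<close> of the value of agent \<open>i\<close>, as a function of the whole
  configuration.  For \<open>j = i\<close> the average over the other agents stays fixed; for \<open>j \<noteq> i\<close> only
  this average varies.
\<close>

definition grad_val ::
  "(real ^ 'd \<Rightarrow> real) \<Rightarrow> 'd::finite agent_data \<Rightarrow> nat \<Rightarrow> real \<Rightarrow> (nat \<Rightarrow> real ^ 'd) \<Rightarrow> nat \<Rightarrow> nat
     \<Rightarrow> real ^ 'd" where
  "grad_val \<Phi> D N t y i j =
     grad (\<lambda>z. val D N t ((y(j := z)) i) (rho_except \<Phi> N (y(j := z)) i)) (y j)"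

text \<open>
  \<open>order_N I g s\<close> renders \<open>g \<sim> O(N\<^sup>s)\<close> for quantities \<open>g N p\<close> that depend, for each number \<open>N\<close> of
  agents, on a further parameter \<open>p \<in> I N\<close> (time, configuration, agent): the constant depends
  neither on \<open>N\<close> nor on \<open>p\<close>.  The averages over the other agents require \<open>N \<ge> 2\<close>.
\<close>

definition order_N :: "(nat \<Rightarrow> 'p set) \<Rightarrow> (nat \<Rightarrow> 'p \<Rightarrow> 'b::real_normed_vector) \<Rightarrow> real \<Rightarrow> bool" where
  "order_N I g s \<longleftrightarrow> (\<exists>C. \<forall>N\<ge>2. \<forall>p\<in>I N. norm (g N p) \<le> C * real N powr s)"

definition agents :: "real \<Rightarrow> nat \<Rightarrow> (real \<times> (nat \<Rightarrow> 'a) \<times> nat) set" where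
  "agents T N = {(t, y, i). t \<in> {0..T} \<and> i < N}"

definition agent_pairs :: "real \<Rightarrow> nat \<Rightarrow> (real \<times> (nat \<Rightarrow> 'a) \<times> nat \<times> nat) set" where
  "agent_pairs T N = {(t, y, i, j). t \<in> {0..T} \<and> i < N \<and> j < N \<and> j \<noteq> i}"

definition admissible :: "real \<Rightarrow> (real ^ 'd \<Rightarrow> real) \<Rightarrow> 'd::finite agent_data \<Rightarrow> bool" where
  "admissible T \<Phi> D \<longleftrightarrow>
     alpha_hat D > 0 \<and> alpha_bar D \<ge> 0 \<and>
     order_N (agents T) (\<lambda>N (t, y, i). drift D t (y i) (rho \<Phi> N y)) 0 \<and>
     order_N (agents T) (\<lambda>N (t, y, i). cost D t (y i) (rho \<Phi> N y)) 0 \<and>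
     order_N (agents T) (\<lambda>N (t, y, i). payoff D (y i) (rho \<Phi> N y)) 0 \<and>
     order_N (agents T) (\<lambda>N (t, y, i). m_hat D t (y i) (rho \<Phi> N y)) 0 \<and>
     order_N (agents T) (\<lambda>N (t, y, i). m_bar D t (y i) (rho \<Phi> N y)) 0 \<and>
     (\<forall>N\<ge>2. \<forall>t\<in>{0..T}. (\<lambda>(x, r). val D N t x r) differentiable_on UNIV) \<and>
     order_N (agents T) (\<lambda>N (t, y, i). grad_val \<Phi> D N t y i i) 0 \<and>
     order_N (agent_pairs T) (\<lambda>N (t, y, i, j). grad_val \<Phi> D N t y i j) (- 1)"

text \<open>
  Rescaling by \<open>\<theta>\<^sub>1\<close> (for \<open>m_hat\<close>), \<open>\<theta>\<^sub>2\<close> (for \<open>m_bar\<close>), \<open>a\<^sub>1\<close> (for \<open>alpha_hat\<close>) and \<open>a\<^sub>2\<close>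
  (for \<open>alpha_bar\<close>).  The coefficient functions and the value function are left unscaled.
\<close>

definition rescale ::
  "real \<Rightarrow> real \<Rightarrow> real \<Rightarrow> real \<Rightarrow> nat \<Rightarrow> 'd::finite agent_data \<Rightarrow> 'd agent_data" where
  "rescale \<theta>\<^sub>1 \<theta>\<^sub>2 a\<^sub>1 a\<^sub>2 N D =
     D\<lparr> m_hat := (\<lambda>t x r. (real N powr - \<theta>\<^sub>1) *\<^sub>R m_hat D t x r),
        m_bar := (\<lambda>t x r. (real N powr - \<theta>\<^sub>2) *\<^sub>R m_bar D t x r),
        alpha_hat := real N powr - a\<^sub>1 * alpha_hat D,
        alpha_bar := real N powr - a\<^sub>2 * alpha_bar D \<rparr>"

definition control ::
  "(real ^ 'd \<Rightarrow> real) \<Rightarrow> 'd::finite agent_data \<Rightarrow> nat \<Rightarrow> real \<Rightarrow> (nat \<Rightarrow> real ^ 'd) \<Rightarrow> nat \<Rightarrow> real"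
  where
  "control \<Phi> D N t y i =
     1 / alpha_hat D * (m_hat D t (y i) (rho \<Phi> N y) \<bullet> grad_val \<Phi> D N t y i i)"

text \<open>
  The terms, besides \<open>drift\<close> and \<open>cost\<close> themselves, whose sum is the velocity, respectively the
  running cost, of agent \<open>i\<close>.
\<close>

definition own_velocity where
  "own_velocity \<Phi> D N t y i = control \<Phi> D N t y i *\<^sub>R m_hat D t (y i) (rho \<Phi> N y)"

definition others_velocity where
  "others_velocity \<Phi> D N t y i =
     (\<Sum>k\<in>{..<N} - {i}. control \<Phi> D N t y k) *\<^sub>R m_bar D t (y i) (rho \<Phi> N y)"

definition own_cost where
  "own_cost \<Phi> D N t y i = alpha_hat D / 2 * (control \<Phi> D N t y i)\<^sup>2"

definition others_cost where
  "others_cost \<Phi> D N t y i =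
     alpha_bar D / 2 * (\<Sum>k\<in>{..<N} - {i}. (control \<Phi> D N t y k)\<^sup>2)"

definition possible_scaling ::
  "real \<Rightarrow> (real ^ 'd::finite \<Rightarrow> real) \<Rightarrow> real \<Rightarrow> real \<Rightarrow> real \<Rightarrow> real \<Rightarrow> bool" where
  "possible_scaling T \<Phi> \<theta>\<^sub>1 \<theta>\<^sub>2 a\<^sub>1 a\<^sub>2 \<longleftrightarrow>
     (\<forall>D. admissible T \<Phi> D \<longrightarrow>
        (let D' = rescale \<theta>\<^sub>1 \<theta>\<^sub>2 a\<^sub>1 a\<^sub>2 in
           order_N (agents T) (\<lambda>N (t, y, i). own_velocity \<Phi> (D' N D) N t y i) 0 \<and>
           order_N (agents T) (\<lambda>N (t, y, i). others_velocity \<Phi> (D' N D) N t y i) 0 \<and>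
           order_N (agents T) (\<lambda>N (t, y, i). own_cost \<Phi> (D' N D) N t y i) 0 \<and>
           order_N (agents T) (\<lambda>N (t, y, i). others_cost \<Phi> (D' N D) N t y i) 0))"

end

theory Submission
  imports Defs "HOL-Real_Asymp.Real_Asymp"
begin

text \<open>
  Each of the four rescaled terms is a fixed power of \<open>N\<close> times its unscaled counterpart.  The
  rescaling multiplies every optimal control by \<open>N\<close> to the \<open>a\<^sub>1 - \<theta>\<^sub>1\<close>, so that the powers are
  \<open>a\<^sub>1 - 2 \<theta>\<^sub>1\<close> for both terms of an agent's own control, \<open>a\<^sub>1 - \<theta>\<^sub>1 - \<theta>\<^sub>2\<close> for the velocity due to
  the others, and \<open>2 a\<^sub>1 - 2 \<theta>\<^sub>1 - a\<^sub>2\<close> for the cost due to the others.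

  The unscaled controls are bounded, since \<open>m_hat\<close> and the gradients are.  Hence the two own terms
  are of order \<open>O(1)\<close> and the two sums over the other agents are of order \<open>O(N)\<close>, and the three
  inequalities suffice.  They are necessary because these orders cannot be improved uniformly: if
  \<open>m_hat\<close>, \<open>m_bar\<close> and the gradient of the value in the agent's own state are all one constant unit
  vector, and \<open>alpha_hat\<close> and \<open>alpha_bar\<close> are \<open>1\<close>, then every unscaled control is \<open>1\<close>,
  there is no cancellation in the sums, and the unscaled terms (own and others' velocity, own and
  others' cost) have norms \<open>1\<close>, \<open>N - 1\<close>, \<open>1 / 2\<close> and \<open>(N - 1) / 2\<close>.
\<close>

section \<open>Orders of magnitude\<close>

lemma order_NE:
  assumes "order_N I g s"
  obtains C where "C \<ge> 0" "\<And>N p. N \<ge> 2 \<Longrightarrow> p \<in> I N \<Longrightarrow> norm (g N p) \<le> C * real N powr s"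
proof -
  obtain C where C: "\<And>N p. N \<ge> 2 \<Longrightarrow> p \<in> I N \<Longrightarrow> norm (g N p) \<le> C * real N powr s"
    using assms unfolding order_N_def by blast
  have "C * real N powr s \<le> max 0 C * real N powr s" for N
    by (intro mult_right_mono) auto
  then show thesis
    using C by (intro that[of "max 0 C"]) (auto intro: order_trans)
qed

lemma order_NI:
  assumes "\<And>N p. N \<ge> 2 \<Longrightarrow> p \<in> I N \<Longrightarrow> norm (g N p) \<le> C * real N powr s"
  shows "order_N I g s"
  using assms unfolding order_N_def by blast

lemma order_N_mono:
  assumes "order_N I g r" "r \<le> s"
  shows "order_N I g s"
proof -
  obtain C where C: "C \<ge> 0" "\<And>N p. N \<ge> 2 \<Longrightarrow> p \<in> I N \<Longrightarrow> norm (g N p) \<le> C * real N powr r"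
    using assms(1) by (rule order_NE) blast
  have "C * real N powr r \<le> C * real N powr s" if "N \<ge> 2" for N
    using that assms(2) C(1) by (intro mult_left_mono powr_mono) auto
  then show ?thesis
    using C(2) by (intro order_NI[of I g C]) (auto intro: order_trans)
qed

lemma order_N_cmult:
  fixes g :: "nat \<Rightarrow> 'p \<Rightarrow> real"
  assumes "order_N I g s"
  shows "order_N I (\<lambda>N p. c * g N p) s"
proof -
  obtain C where "\<And>N p. N \<ge> 2 \<Longrightarrow> p \<in> I N \<Longrightarrow> norm (g N p) \<le> C * real N powr s"
    using assms by (rule order_NE) blast
  then show ?thesis
    by (intro order_NI[where C = "\<bar>c\<bar> * C"]) (auto simp: abs_mult mult.assoc intro: mult_left_mono)
qed

lemma order_N_product_bound:
  assumes "order_N I f r" "order_N I g s"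
    and le: "\<And>N p. N \<ge> 2 \<Longrightarrow> p \<in> I N \<Longrightarrow> norm (h N p) \<le> K * (norm (f N p) * norm (g N p))"
    and "K \<ge> 0"
  shows "order_N I h (r + s)"
proof -
  obtain C where C: "C \<ge> 0" "\<And>N p. N \<ge> 2 \<Longrightarrow> p \<in> I N \<Longrightarrow> norm (f N p) \<le> C * real N powr r"
    using assms(1) by (rule order_NE) blast
  obtain C' where C': "C' \<ge> 0" "\<And>N p. N \<ge> 2 \<Longrightarrow> p \<in> I N \<Longrightarrow> norm (g N p) \<le> C' * real N powr s"
    using assms(2) by (rule order_NE) blast
  show ?thesis
  proof (rule order_NI)
    fix N :: nat and p assume N: "N \<ge> 2" and p: "p \<in> I N"
    have "K * (norm (f N p) * norm (g N p))
        \<le> K * ((C * real N powr r) * (C' * real N powr s))"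
      using C C' N p \<open>K \<ge> 0\<close> by (intro mult_left_mono mult_mono) auto
    also have "\<dots> = (K * C * C') * real N powr (r + s)"
      by (simp add: powr_add)
    finally show "norm (h N p) \<le> (K * C * C') * real N powr (r + s)"
      using le[OF N p] by simp
  qed
qed

lemma order_N_powr_scaleR_iff:
  "order_N I (\<lambda>N p. (real N powr r) *\<^sub>R g N p) s \<longleftrightarrow> order_N I g (s - r)"
proof -
  have "norm ((real N powr r) *\<^sub>R g N p) \<le> C * real N powr s
      \<longleftrightarrow> norm (g N p) \<le> C * real N powr (s - r)" if "N \<ge> 2" for C N p
    using that by (simp add: powr_diff field_simps)
  then show ?thesis
    unfolding order_N_def by (metis (no_types, lifting))
qed

lemma order_N_sum_others:
  fixes g :: "nat \<Rightarrow> real \<Rightarrow> (nat \<Rightarrow> 'a) \<Rightarrow> nat \<Rightarrow> 'b::real_normed_vector"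
  assumes "order_N (agents T) (\<lambda>N (t, y, i). g N t y i) s"
  shows "order_N (agents T) (\<lambda>N (t, y, i). \<Sum>k\<in>{..<N} - {i}. g N t y k) (s + 1)"
proof -
  obtain C where C: "C \<ge> 0" "\<And>N p. N \<ge> 2 \<Longrightarrow> p \<in> agents T N
      \<Longrightarrow> norm (case p of (t, y, i) \<Rightarrow> g N t y i) \<le> C * real N powr s"
    using assms by (rule order_NE) blast
  show ?thesis
  proof (rule order_NI, clarify)
    fix N :: nat and t y i assume N: "N \<ge> 2" and p: "(t, y :: nat \<Rightarrow> 'a, i) \<in> agents T N"
    have "norm (\<Sum>k\<in>{..<N} - {i}. g N t y k) \<le> (\<Sum>k\<in>{..<N} - {i}. C * real N powr s)"
    proof (rule sum_norm_le)
      fix k assume "k \<in> {..<N} - {i}"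
      then have "(t, y, k) \<in> agents T N"
        using p by (simp add: agents_def)
      from C(2)[OF N this] show "norm (g N t y k) \<le> C * real N powr s"
        by simp
    qed
    also have "\<dots> \<le> (\<Sum>k<N. C * real N powr s)"
      using C(1) by (intro sum_mono2) auto
    also have "\<dots> = C * real N powr (s + 1)"
      using N by (simp add: powr_add)
    finally show "norm (\<Sum>k\<in>{..<N} - {i}. g N t y k) \<le> C * real N powr (s + 1)" .
  qed
qed

lemma powr_le_imp_exponent_le:
  assumes "c > 0" "\<And>N. N \<ge> 2 \<Longrightarrow> c * real N powr r \<le> C * real N powr s"
  shows "r \<le> s"
proof (rule ccontr)
  assume "\<not> r \<le> s"
  then have "filterlim (\<lambda>N. real N powr (r - s)) at_top sequentially"
    by real_asymp
  then have "eventually (\<lambda>N. real N powr (r - s) > C / c \<and> N \<ge> 2) sequentially"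
    by (intro eventually_conj filterlim_at_top_dense[THEN iffD1, rule_format] eventually_ge_at_top)
  then obtain N where "real N powr (r - s) > C / c" "N \<ge> 2"
    by (auto simp: eventually_sequentially)
  then have "c * real N powr r > C * real N powr s"
    using assms(1) by (simp add: powr_diff field_simps)
  with assms(2)[OF \<open>N \<ge> 2\<close>] show False
    by simp
qed

lemma order_N_lower_bound:
  assumes "order_N I g s" "c > 0"
    and "\<And>N. N \<ge> 2 \<Longrightarrow> \<exists>p\<in>I N. c * real N powr r \<le> norm (g N p)"
  shows "r \<le> s"
proof -
  obtain C where "\<And>N p. N \<ge> 2 \<Longrightarrow> p \<in> I N \<Longrightarrow> norm (g N p) \<le> C * real N powr s"
    using assms(1) by (rule order_NE) blast
  then have "c * real N powr r \<le> C * real N powr s" if "N \<ge> 2" for N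
    using assms(3)[OF that] that by (meson order_trans)
  with \<open>c > 0\<close> show ?thesis
    by (rule powr_le_imp_exponent_le)
qed

section \<open>Effect of the rescaling\<close>

lemma control_rescale:
  "control \<Phi> (rescale \<theta>\<^sub>1 \<theta>\<^sub>2 a\<^sub>1 a\<^sub>2 N D) N t y
     = (\<lambda>i. real N powr (a\<^sub>1 - \<theta>\<^sub>1) * control \<Phi> D N t y i)"
  by (simp add: fun_eq_iff control_def rescale_def grad_val_def powr_diff powr_minus field_simps)

lemma own_velocity_rescale:
  "own_velocity \<Phi> (rescale \<theta>\<^sub>1 \<theta>\<^sub>2 a\<^sub>1 a\<^sub>2 N D) N t y i
     = (real N powr (a\<^sub>1 - 2 * \<theta>\<^sub>1)) *\<^sub>R own_velocity \<Phi> D N t y i"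
proof -
  have "a\<^sub>1 - 2 * \<theta>\<^sub>1 = (a\<^sub>1 - \<theta>\<^sub>1) + - \<theta>\<^sub>1"
    by simp
  then show ?thesis
    unfolding own_velocity_def control_rescale by (simp only: powr_add) (simp add: rescale_def)
qed

lemma others_velocity_rescale:
  "others_velocity \<Phi> (rescale \<theta>\<^sub>1 \<theta>\<^sub>2 a\<^sub>1 a\<^sub>2 N D) N t y i
     = (real N powr (a\<^sub>1 - \<theta>\<^sub>1 - \<theta>\<^sub>2)) *\<^sub>R others_velocity \<Phi> D N t y i"
proof -
  have "a\<^sub>1 - \<theta>\<^sub>1 - \<theta>\<^sub>2 = (a\<^sub>1 - \<theta>\<^sub>1) + - \<theta>\<^sub>2"
    by simp
  then show ?thesis
    unfolding others_velocity_def control_rescale sum_distrib_left[symmetric]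
    by (simp only: powr_add) (simp add: rescale_def)
qed

lemma own_cost_rescale:
  "own_cost \<Phi> (rescale \<theta>\<^sub>1 \<theta>\<^sub>2 a\<^sub>1 a\<^sub>2 N D) N t y i
     = (real N powr (a\<^sub>1 - 2 * \<theta>\<^sub>1)) *\<^sub>R own_cost \<Phi> D N t y i"
proof -
  have "a\<^sub>1 - 2 * \<theta>\<^sub>1 = - a\<^sub>1 + ((a\<^sub>1 - \<theta>\<^sub>1) + (a\<^sub>1 - \<theta>\<^sub>1))"
    by simp
  then show ?thesis
    unfolding own_cost_def control_rescale
    by (simp only: powr_add) (simp add: rescale_def power2_eq_square)
qed

lemma others_cost_rescale:
  "others_cost \<Phi> (rescale \<theta>\<^sub>1 \<theta>\<^sub>2 a\<^sub>1 a\<^sub>2 N D) N t y i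
     = (real N powr (2 * a\<^sub>1 - 2 * \<theta>\<^sub>1 - a\<^sub>2)) *\<^sub>R others_cost \<Phi> D N t y i"
proof -
  have "2 * a\<^sub>1 - 2 * \<theta>\<^sub>1 - a\<^sub>2 = - a\<^sub>2 + ((a\<^sub>1 - \<theta>\<^sub>1) + (a\<^sub>1 - \<theta>\<^sub>1))"
    by simp
  then show ?thesis
    unfolding others_cost_def control_rescale power_mult_distrib sum_distrib_left[symmetric]
    by (simp only: powr_add) (simp add: rescale_def power2_eq_square)
qed

text \<open>
  The powers of \<open>N\<close> move to the right-hand side: a scaling is possible iff the unscaled terms obey
  bounds whose exponents depend on the scaling.
\<close>

lemma possible_scaling_iff_unscaled:
  fixes \<Phi> :: "real ^ 'd::finite \<Rightarrow> real"
  shows "possible_scaling T \<Phi> \<theta>\<^sub>1 \<theta>\<^sub>2 a\<^sub>1 a\<^sub>2 \<longleftrightarrow>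
     (\<forall>D. admissible T \<Phi> D \<longrightarrow>
        order_N (agents T) (\<lambda>N (t, y, i). own_velocity \<Phi> D N t y i) (2 * \<theta>\<^sub>1 - a\<^sub>1) \<and>
        order_N (agents T) (\<lambda>N (t, y, i). others_velocity \<Phi> D N t y i) (\<theta>\<^sub>1 + \<theta>\<^sub>2 - a\<^sub>1) \<and>
        order_N (agents T) (\<lambda>N (t, y, i). own_cost \<Phi> D N t y i) (2 * \<theta>\<^sub>1 - a\<^sub>1) \<and>
        order_N (agents T) (\<lambda>N (t, y, i). others_cost \<Phi> D N t y i) (2 * \<theta>\<^sub>1 + a\<^sub>2 - 2 * a\<^sub>1))"
proof -
  have scaled: "order_N (agents T) (\<lambda>N p. (real N powr r) *\<^sub>R g N p) 0
      \<longleftrightarrow> order_N (agents T) g (- r)"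
    for r and g :: "nat \<Rightarrow> real \<times> (nat \<Rightarrow> real ^ 'd) \<times> nat \<Rightarrow> 'b::real_normed_vector"
    using order_N_powr_scaleR_iff[of "agents T" r g 0] by simp
  have "- (a\<^sub>1 - 2 * \<theta>\<^sub>1) = 2 * \<theta>\<^sub>1 - a\<^sub>1" "- (a\<^sub>1 - \<theta>\<^sub>1 - \<theta>\<^sub>2) = \<theta>\<^sub>1 + \<theta>\<^sub>2 - a\<^sub>1"
    "- (2 * a\<^sub>1 - 2 * \<theta>\<^sub>1 - a\<^sub>2) = 2 * \<theta>\<^sub>1 + a\<^sub>2 - 2 * a\<^sub>1"
    by simp_all
  then show ?thesis
    unfolding possible_scaling_def Let_def case_prod_unfold own_velocity_rescale
      others_velocity_rescale own_cost_rescale others_cost_rescale scaled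
    by (simp only:)
qed

section \<open>Upper bounds for the unscaled terms\<close>

lemma order_N_control:
  assumes "admissible T \<Phi> D"
  shows "order_N (agents T) (\<lambda>N (t, y, i). control \<Phi> D N t y i) 0"
proof -
  have "order_N (agents T) (\<lambda>N (t, y, i). control \<Phi> D N t y i) (0 + 0)"
  proof (rule order_N_product_bound)
    show "order_N (agents T) (\<lambda>N (t, y, i). m_hat D t (y i) (rho \<Phi> N y)) 0"
      "order_N (agents T) (\<lambda>N (t, y, i). grad_val \<Phi> D N t y i i) 0"
      using assms by (auto simp: admissible_def)
    show "1 / alpha_hat D \<ge> 0"
      using assms by (simp add: admissible_def)
  qed (use assms in \<open>auto simp: admissible_def control_def abs_mult
          intro!: divide_right_mono Cauchy_Schwarz_ineq2\<close>)
  then show ?thesis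
    by simp
qed

lemma order_N_control_square:
  assumes "admissible T \<Phi> D"
  shows "order_N (agents T) (\<lambda>N (t, y, i). (control \<Phi> D N t y i)\<^sup>2) 0"
proof -
  have "order_N (agents T) (\<lambda>N (t, y, i). (control \<Phi> D N t y i)\<^sup>2) (0 + 0)"
    by (rule order_N_product_bound[OF order_N_control[OF assms] order_N_control[OF assms], of _ 1])
      (auto simp: power2_eq_square abs_mult)
  then show ?thesis
    by simp
qed

lemma order_N_own_velocity:
  assumes "admissible T \<Phi> D"
  shows "order_N (agents T) (\<lambda>N (t, y, i). own_velocity \<Phi> D N t y i) 0"
proof -
  have "order_N (agents T) (\<lambda>N (t, y, i). own_velocity \<Phi> D N t y i) (0 + 0)"
  proof (rule order_N_product_bound[OF order_N_control[OF assms], of _ _ _ 1])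
    show "order_N (agents T) (\<lambda>N (t, y, i). m_hat D t (y i) (rho \<Phi> N y)) 0"
      using assms by (simp add: admissible_def)
  qed (auto simp: own_velocity_def)
  then show ?thesis
    by simp
qed

lemma order_N_others_velocity:
  assumes "admissible T \<Phi> D"
  shows "order_N (agents T) (\<lambda>N (t, y, i). others_velocity \<Phi> D N t y i) 1"
proof -
  have "order_N (agents T) (\<lambda>N (t, y, i). others_velocity \<Phi> D N t y i) ((0 + 1) + 0)"
  proof (rule order_N_product_bound[OF order_N_sum_others[OF order_N_control[OF assms]], of _ _ _ 1])
    show "order_N (agents T) (\<lambda>N (t, y, i). m_bar D t (y i) (rho \<Phi> N y)) 0"
      using assms by (simp add: admissible_def)
  qed (auto simp: others_velocity_def)
  then show ?thesis
    by simp
qed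

lemma order_N_own_cost:
  assumes "admissible T \<Phi> D"
  shows "order_N (agents T) (\<lambda>N (t, y, i). own_cost \<Phi> D N t y i) 0"
  using order_N_cmult[OF order_N_control_square[OF assms], of "alpha_hat D / 2"]
  by (simp add: own_cost_def case_prod_unfold)

lemma order_N_others_cost:
  assumes "admissible T \<Phi> D"
  shows "order_N (agents T) (\<lambda>N (t, y, i). others_cost \<Phi> D N t y i) 1"
  using order_N_cmult[OF order_N_sum_others[OF order_N_control_square[OF assms]],
      of "alpha_bar D / 2"]
  by (simp add: others_cost_def case_prod_unfold)

section \<open>Sharpness\<close>

lemma grad_eqI:
  assumes "GDERIV f x :> D"
  shows "grad f x = D"
  unfolding grad_def
proof (rule the_equality)
  show "GDERIV f x :> D"
    by (fact assms)
next
  fix D' assume "GDERIV f x :> D'"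
  with assms have "(\<lambda>h. h \<bullet> D') = (\<lambda>h. h \<bullet> D)"
    unfolding gderiv_def by (rule has_derivative_unique[rotated])
  then show "D' = D"
    by (metis inner_commute vector_eq_ldot)
qed

text \<open>
  Data attaining the upper bounds: \<open>m_hat\<close> and \<open>m_bar\<close> are constantly the vector \<open>e\<close>, and
  the value is linear with gradient \<open>e\<close> and independent of the average over the other agents.
\<close>

definition aligned_data :: "real ^ 'd \<Rightarrow> 'd agent_data" where
  "aligned_data e =
     \<lparr> drift = (\<lambda>_ _ _. 0), m_hat = (\<lambda>_ _ _. e), m_bar = (\<lambda>_ _ _. e), cost = (\<lambda>_ _ _. 0),
       payoff = (\<lambda>_ _. 0), alpha_hat = 1, alpha_bar = 1, val = (\<lambda>_ _ x _. e \<bullet> x) \<rparr>"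

lemma grad_val_aligned_data:
  fixes e :: "real ^ 'd::finite"
  shows "grad_val \<Phi> (aligned_data e) N t y i j = (if j = i then e else 0)"
  unfolding grad_val_def aligned_data_def
  by (rule grad_eqI) (auto simp: gderiv_def inner_commute intro!: derivative_eq_intros)

lemma admissible_aligned_data:
  fixes e :: "real ^ 'd::finite"
  shows "admissible T \<Phi> (aligned_data e)"
proof -
  have const: "order_N (agents T) (\<lambda>N (t :: real, y :: nat \<Rightarrow> real ^ 'd, i :: nat). v) 0"
    for v :: "'b::real_normed_vector"
    by (rule order_NI[where C = "norm v"]) auto
  have "order_N (agent_pairs T)
      (\<lambda>N (t, y, i, j). grad_val \<Phi> (aligned_data e) N t y i j) (- 1)"
    by (rule order_NI[where C = 0]) (auto simp: agent_pairs_def grad_val_aligned_data)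
  moreover have "(\<lambda>(x, r). val (aligned_data e) N t x r) differentiable_on UNIV" for N t
    unfolding aligned_data_def case_prod_unfold
    by (auto intro!: linear_imp_differentiable_on bounded_linear.linear
        bounded_linear_inner_right_comp bounded_linear_fst)
  ultimately show ?thesis
    unfolding admissible_def grad_val_aligned_data by (simp add: aligned_data_def const)
qed

lemma control_aligned_data:
  assumes "norm e = 1"
  shows "control \<Phi> (aligned_data e) N t y i = 1"
  using assms unfolding control_def grad_val_aligned_data
  by (simp add: aligned_data_def dot_square_norm)

lemma possible_scaling_imp_exponents:
  fixes \<Phi> :: "real ^ 'd::finite \<Rightarrow> real"
  assumes "0 \<le> T" "possible_scaling T \<Phi> \<theta>\<^sub>1 \<theta>\<^sub>2 a\<^sub>1 a\<^sub>2"
  shows "0 \<le> 2 * \<theta>\<^sub>1 - a\<^sub>1" "1 \<le> \<theta>\<^sub>1 + \<theta>\<^sub>2 - a\<^sub>1" "1 \<le> 2 * \<theta>\<^sub>1 + a\<^sub>2 - 2 * a\<^sub>1"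
proof -
  obtain e :: "real ^ 'd" where e: "norm e = 1"
    using vector_choose_size[of 1] by auto
  define D where "D = aligned_data e"
  have orders:
    "order_N (agents T) (\<lambda>N (t, y, i). own_velocity \<Phi> D N t y i) (2 * \<theta>\<^sub>1 - a\<^sub>1)"
    "order_N (agents T) (\<lambda>N (t, y, i). others_velocity \<Phi> D N t y i) (\<theta>\<^sub>1 + \<theta>\<^sub>2 - a\<^sub>1)"
    "order_N (agents T) (\<lambda>N (t, y, i). others_cost \<Phi> D N t y i) (2 * \<theta>\<^sub>1 + a\<^sub>2 - 2 * a\<^sub>1)"
    using assms(2) admissible_aligned_data[of T \<Phi> e]
    unfolding possible_scaling_iff_unscaled D_def by blast+
  have sharp: "r \<le> s"
    if "order_N (agents T) (\<lambda>N (t, y, i). g N t y i) s" "c > 0"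
      "\<And>N. N \<ge> 2 \<Longrightarrow> c * real N powr r \<le> norm (g N 0 (\<lambda>_. 0) 0)"
    for c r s and g :: "nat \<Rightarrow> real \<Rightarrow> (nat \<Rightarrow> real ^ 'd) \<Rightarrow> nat \<Rightarrow> 'b::real_normed_vector"
  proof (rule order_N_lower_bound[OF that(1,2)])
    fix N :: nat assume "N \<ge> 2"
    then show "\<exists>p\<in>agents T N. c * real N powr r \<le> norm (case p of (t, y, i) \<Rightarrow> g N t y i)"
      using that(3) assms(1) by (intro bexI[of _ "(0, \<lambda>_. 0, 0)"]) (auto simp: agents_def)
  qed
  have control: "control \<Phi> D N t y i = 1" for N t y i
    using e by (simp add: D_def control_aligned_data)
  have D: "m_hat D = (\<lambda>_ _ _. e)" "m_bar D = (\<lambda>_ _ _. e)" "alpha_bar D = 1"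
    by (simp_all add: D_def aligned_data_def)
  show "0 \<le> 2 * \<theta>\<^sub>1 - a\<^sub>1"
    by (rule sharp[OF orders(1), of 1])
      (auto simp: own_velocity_def control D e)
  \<comment> \<open>The constants come from \<open>N - 1 \<ge> N / 2\<close>, valid as \<open>N \<ge> 2\<close>; the cost is halved once more.\<close>
  show "1 \<le> \<theta>\<^sub>1 + \<theta>\<^sub>2 - a\<^sub>1"
    by (rule sharp[OF orders(2), of "1 / 2"])
      (auto simp: others_velocity_def control D e)
  show "1 \<le> 2 * \<theta>\<^sub>1 + a\<^sub>2 - 2 * a\<^sub>1"
    by (rule sharp[OF orders(3), of "1 / 4"])
      (auto simp: others_cost_def control D e)
qed

section \<open>The set of possible scalings\<close>

theorem lemma3:
  fixes T :: real and \<Phi> :: "real ^ 'd::finite \<Rightarrow> real"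
  assumes "0 \<le> T" and "real_polynomial_function \<Phi>"
  shows "{(\<theta>\<^sub>1, \<theta>\<^sub>2, a\<^sub>1, a\<^sub>2).
            a\<^sub>2 \<ge> 1 \<and> \<theta>\<^sub>2 \<ge> 1 \<and> a\<^sub>1 \<ge> 0 \<and> \<theta>\<^sub>1 \<ge> 0 \<and> possible_scaling T \<Phi> \<theta>\<^sub>1 \<theta>\<^sub>2 a\<^sub>1 a\<^sub>2} =
         {(\<theta>\<^sub>1, \<theta>\<^sub>2, a\<^sub>1, a\<^sub>2).
            a\<^sub>2 \<ge> 1 \<and> \<theta>\<^sub>2 \<ge> 1 \<and> a\<^sub>1 \<ge> 0 \<and> \<theta>\<^sub>1 \<ge> 0 \<and>
            a\<^sub>1 - 2 * \<theta>\<^sub>1 \<le> 0 \<and>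
            a\<^sub>1 + 1 - \<theta>\<^sub>1 - \<theta>\<^sub>2 \<le> 0 \<and>
            2 * a\<^sub>1 + 1 - 2 * \<theta>\<^sub>1 - a\<^sub>2 \<le> 0}"
proof -
  have "possible_scaling T \<Phi> \<theta>\<^sub>1 \<theta>\<^sub>2 a\<^sub>1 a\<^sub>2 \<longleftrightarrow>
      a\<^sub>1 - 2 * \<theta>\<^sub>1 \<le> 0 \<and> a\<^sub>1 + 1 - \<theta>\<^sub>1 - \<theta>\<^sub>2 \<le> 0 \<and> 2 * a\<^sub>1 + 1 - 2 * \<theta>\<^sub>1 - a\<^sub>2 \<le> 0"
    (is "?possible \<longleftrightarrow> ?exponents") for \<theta>\<^sub>1 \<theta>\<^sub>2 a\<^sub>1 a\<^sub>2
  proof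
    assume ?possible
    from possible_scaling_imp_exponents[OF assms(1) this] show ?exponents
      by simp
  next
    assume ?exponents
    then show ?possible
      unfolding possible_scaling_iff_unscaled
      by (auto intro: order_N_mono[OF order_N_own_velocity] order_N_mono[OF order_N_others_velocity]
          order_N_mono[OF order_N_own_cost] order_N_mono[OF order_N_others_cost])
  qed
  then show ?thesis
    by simp
qed

end
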